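(* Let $d \in \{2,3\}$. Let $R = \{r_1, r_2\}$, where both of the rotations $r_1$ and $r_2$ are of infinite order and: if $d = 2$, $r_1$ and $r_2$ are rotations of $\mathbb{R}^2$ about points $U_1 \neq U_2$ respectively; if $d = 3$, $r_1$ and $r_2$ are rotations of $\mathbb{R}^3$ about skew directed lines $X_1$ and $X_2$ respectively. Let $\mathcal{S} := \mathcal{S}(R)$ be the stationary group determined by $R$. Then the orbit $V\mathcal{S} := \{Vf : f \in \mathcal{S}\}$ is dense in $\mathbb{R}^d$ for every $V \in \mathbb{R}^d$.
   Context: Isometries act on the right: $Vf$ is the image of the point $V$ under the isometry $f$. Skew lines are lines that are neither parallel nor intersecting. The stationary group $\mathcal{S}(R)$ is the group of isometries of $\mathbb{R}^d$ generated by $R$ under ordinary composition written left to right, $P(f \circ h) = (Pf)h$; its elements are the finite products $g_{j_1} \circ g_{j_2} \circ \cdots \circ g_{j_k}$ with each $g_{j_t}$ in the cyclic group $\mathcal{G}_{j_t} = \{r_{j_t}^z : z \in \mathbb{Z}\}$. The rotational axes are fixed in $\mathbb{R}^d$ and are not moved by the action of the group. *)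

theory Defs
  imports "HOL-Analysis.Analysis" "HOL-Algebra.Generated_Groups" "HOL-Algebra.Multiplicative_Group"
begin

text \<open>
  The product is composition written left to right, \<open>P (f \<circ> h) = (P f) h\<close>; the image \<open>V f\<close> of the
  right action is the function application \<open>f V\<close>.
\<close>

definition isometry_group :: "('a::metric_space \<Rightarrow> 'a) monoid" where
  "isometry_group =
     \<lparr>carrier = {f. bij f \<and> (\<forall>x y. dist (f x) (f y) = dist x y)},
      mult = (\<lambda>f h x. h (f x)),
      one = (\<lambda>x. x)\<rparr>"

definition stationary_group :: "('a::metric_space \<Rightarrow> 'a) set \<Rightarrow> ('a \<Rightarrow> 'a) set" where
  "stationary_group R = generate isometry_group R"

definition orbit_of :: "'a \<Rightarrow> ('a \<Rightarrow> 'a) set \<Rightarrow> 'a set" where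
  "orbit_of V S = {f V | f. f \<in> S}"

text \<open>In HOL-Algebra, an element of infinite order has \<open>ord\<close> equal to \<open>0\<close>.\<close>

definition infinite_order :: "('a::metric_space \<Rightarrow> 'a) \<Rightarrow> bool" where
  "infinite_order r \<longleftrightarrow> group.ord isometry_group r = 0"

text \<open>Counterclockwise rotation of the plane about the point \<open>U\<close> by the angle \<open>t\<close>.\<close>

definition rotation2 :: "real^2 \<Rightarrow> real \<Rightarrow> real^2 \<Rightarrow> real^2" where
  "rotation2 U t P =
     U + vector [cos t * (P - U)$1 - sin t * (P - U)$2,
                 sin t * (P - U)$1 + cos t * (P - U)$2]"

text \<open>
  A directed line is given by a point \<open>A\<close> on it and a unit vector \<open>u\<close>, its direction.
  The points of the line do not depend on the sense of \<open>u\<close>.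
\<close>

definition line_through :: "real^3 \<Rightarrow> real^3 \<Rightarrow> (real^3) set" where
  "line_through A u = {A + s *\<^sub>R u | s. True}"

definition skew :: "(real^3) set \<Rightarrow> (real^3) set \<Rightarrow> bool" where
  "skew L M \<longleftrightarrow> \<not> affine_parallel L M \<and> L \<inter> M = {}"

text \<open>
  Rodrigues' formula for the rotation by the angle \<open>t\<close>, right-handed with respect to the unit
  vector \<open>u\<close>, about the line through \<open>A\<close> with direction \<open>u\<close>.
\<close>

definition rotation3 :: "real^3 \<Rightarrow> real^3 \<Rightarrow> real \<Rightarrow> real^3 \<Rightarrow> real^3" where
  "rotation3 A u t P =
     A + cos t *\<^sub>R (P - A) + sin t *\<^sub>R cross3 u (P - A)
       + ((1 - cos t) * (u \<bullet> (P - A))) *\<^sub>R u"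

lemma group_isometry_group: "group isometry_group"
proof (rule groupI)
  fix f h :: "'a \<Rightarrow> 'a"
  assume f: "f \<in> carrier isometry_group" and h: "h \<in> carrier isometry_group"
  then have "bij (h \<circ> f)"
    by (intro bij_comp) (simp_all add: isometry_group_def)
  then show "f \<otimes>\<^bsub>isometry_group\<^esub> h \<in> carrier isometry_group"
    using f h by (simp add: isometry_group_def comp_def)
next
  fix f :: "'a \<Rightarrow> 'a" assume f: "f \<in> carrier isometry_group"
  then have bij: "bij f" and d: "\<And>x y. dist (f x) (f y) = dist x y"
    by (simp_all add: isometry_group_def)
  have surj: "f (inv_into UNIV f x) = x" for x
    using bij by (simp add: bij_def surj_f_inv_f)
  have "dist (inv_into UNIV f x) (inv_into UNIV f y) = dist x y" for x y
    using d[of "inv_into UNIV f x" "inv_into UNIV f y"] by (simp add: surj)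
  then have "inv_into UNIV f \<in> carrier isometry_group"
    by (simp add: isometry_group_def bij_imp_bij_inv bij)
  moreover have "inv_into UNIV f \<otimes>\<^bsub>isometry_group\<^esub> f = \<one>\<^bsub>isometry_group\<^esub>"
    by (simp add: isometry_group_def surj)
  ultimately show "\<exists>h\<in>carrier isometry_group. h \<otimes>\<^bsub>isometry_group\<^esub> f = \<one>\<^bsub>isometry_group\<^esub>"
    by blast
qed (simp_all add: isometry_group_def bij_id[unfolded id_def])

lemma infinite_order_iff:
  assumes "r \<in> carrier isometry_group"
  shows "infinite_order r \<longleftrightarrow> (\<forall>n>0. r ^^ n \<noteq> (\<lambda>x. x))"
proof -
  have pow: "r [^]\<^bsub>isometry_group\<^esub> n = r ^^ n" for n :: nat
    by (induction n) (simp_all add: isometry_group_def nat_pow_def fun_eq_iff)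
  show ?thesis
    unfolding infinite_order_def group.ord_eq_0[OF group_isometry_group assms] pow
    by (simp add: isometry_group_def)
qed

lemma rotation2_isometry: "rotation2 U t \<in> carrier isometry_group"
proof -
  have inv: "rotation2 U (- t) (rotation2 U t P) = P" for t P
  proof -
    have sc: "(cos t)\<^sup>2 + (sin t)\<^sup>2 = 1" by simp
    have "cos t * (cos t * x - sin t * y) + sin t * (sin t * x + cos t * y)
        = ((cos t)\<^sup>2 + (sin t)\<^sup>2) * x"
      "cos t * (sin t * x + cos t * y) - sin t * (cos t * x - sin t * y)
        = ((cos t)\<^sup>2 + (sin t)\<^sup>2) * y" for x y
      by (simp_all only: power2_eq_square ring_distribs) (simp_all add: mult_ac)
    note this[unfolded sc mult_1]
    then show ?thesis
      unfolding rotation2_def vec_eq_iff forall_2 by simp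
  qed
  have "bij (rotation2 U t)"
    using inv[of t] inv[of "- t"] by (intro bij_betw_byWitness[where f' = "rotation2 U (- t)"]) auto
  moreover have "dist (rotation2 U t x) (rotation2 U t y) = dist x y" for x y
  proof -
    have sc: "(cos t)\<^sup>2 + (sin t)\<^sup>2 = 1" by simp
    have "(cos t * a - sin t * b)\<^sup>2 + (sin t * a + cos t * b)\<^sup>2
        = ((cos t)\<^sup>2 + (sin t)\<^sup>2) * (a\<^sup>2 + b\<^sup>2)" for a b
      by (simp only: power2_eq_square ring_distribs) (simp add: mult_ac)
    note eq = this[unfolded sc mult_1]
    have "(rotation2 U t x - rotation2 U t y)$1 = cos t * (x - y)$1 - sin t * (x - y)$2"
      "(rotation2 U t x - rotation2 U t y)$2 = sin t * (x - y)$1 + cos t * (x - y)$2"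
      by (simp_all add: rotation2_def algebra_simps)
    then show ?thesis
      by (simp only: dist_norm norm_vec_def L2_set_def sum_2 real_norm_def power2_abs eq)
  qed
  ultimately show ?thesis by (simp add: isometry_group_def)
qed

lemma rotation3_isometry:
  assumes "norm u = 1"
  shows "rotation3 A u t \<in> carrier isometry_group"
proof -
  define L where
    "L = (\<lambda>t w. cos t *\<^sub>R w + sin t *\<^sub>R cross3 u w + ((1 - cos t) * (u \<bullet> w)) *\<^sub>R u)"
  have R: "rotation3 A u t P = A + L t (P - A)" for t P
    by (simp add: rotation3_def L_def)
  have uu: "u \<bullet> u = 1" using assms by (simp add: norm_eq_1)
  have sc: "(cos t)\<^sup>2 + (sin t)\<^sup>2 = 1" for t :: real by simp
  have uL: "u \<bullet> L t w = u \<bullet> w" for t w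
    by (simp add: L_def inner_add_right uu dot_cross_self left_diff_distrib)
  have ccw: "cross3 u (cross3 u w) = (u \<bullet> w) *\<^sub>R u - w" for w
    using Lagrange[of u u w] uu by simp
  have cL: "cross3 u (L t w) = cos t *\<^sub>R cross3 u w + sin t *\<^sub>R ((u \<bullet> w) *\<^sub>R u - w)" for t w
    by (simp add: L_def cross_add_right cross_mult_right ccw)
  have "L (- t) (L t w) = w" for t w
  proof -
    have "L (- t) (L t w) = cos t *\<^sub>R L t w - sin t *\<^sub>R cross3 u (L t w)
        + ((1 - cos t) * (u \<bullet> L t w)) *\<^sub>R u"
      by (simp add: L_def)
    also have "\<dots> = ((cos t)\<^sup>2 + (sin t)\<^sup>2) *\<^sub>R w
        + ((1 - ((cos t)\<^sup>2 + (sin t)\<^sup>2)) * (u \<bullet> w)) *\<^sub>R u"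
    proof -
      have "c * (c * x + s * y + (1 - c) * d * z) - s * (c * y + s * (d * z - x)) + (1 - c) * d * z
          = (c\<^sup>2 + s\<^sup>2) * x + (1 - (c\<^sup>2 + s\<^sup>2)) * d * z" for c s d x y z :: real
        by (simp add: algebra_simps power2_eq_square)
      then show ?thesis
        unfolding uL cL unfolding L_def
        by (simp only: vec_eq_iff vector_add_component vector_minus_component
            vector_scaleR_component real_scaleR_def) simp
    qed
    also have "\<dots> = w" by (simp only: sc) simp
    finally show ?thesis .
  qed
  then have inv: "rotation3 A u (- t) (rotation3 A u t P) = P" for t P
    by (simp add: R)
  have "bij (rotation3 A u t)"
    using inv[of t] inv[of "- t"] by (intro bij_betw_byWitness[where f' = "rotation3 A u (- t)"]) auto
  moreover have "dist (rotation3 A u t x) (rotation3 A u t y) = dist x y" for x y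
  proof -
    have "L t w \<bullet> L t w = w \<bullet> w" for w
    proof -
      have "L t w \<bullet> L t w = (cos t)\<^sup>2 * (w \<bullet> w) + (sin t)\<^sup>2 * (cross3 u w \<bullet> cross3 u w)
          + 2 * cos t * (1 - cos t) * (u \<bullet> w)\<^sup>2 + (1 - cos t)\<^sup>2 * (u \<bullet> w)\<^sup>2"
        unfolding L_def inner_add_left inner_add_right inner_scaleR_left inner_scaleR_right
          dot_cross_self uu inner_commute[of w u]
        by (simp add: power2_eq_square algebra_simps)
      moreover have "cross3 u w \<bullet> cross3 u w = w \<bullet> w - (u \<bullet> w)\<^sup>2"
        by (simp add: dot_cross uu inner_commute power2_eq_square)
      moreover have "c\<^sup>2 * a + s\<^sup>2 * (a - b\<^sup>2) + 2 * c * (1 - c) * b\<^sup>2 + (1 - c)\<^sup>2 * b\<^sup>2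
          = (c\<^sup>2 + s\<^sup>2) * a + (1 - (c\<^sup>2 + s\<^sup>2)) * b\<^sup>2" for a b c s :: real
        by (simp add: power2_eq_square algebra_simps)
      ultimately show ?thesis by (simp only: sc) simp
    qed
    moreover have "rotation3 A u t x - rotation3 A u t y = L t (x - y)"
    proof -
      have "x - y = (x - A) - (y - A)" by simp
      then show ?thesis
        by (simp only: R L_def Cross3.right_diff_distrib inner_diff_right right_diff_distrib
            scaleR_diff_right scaleR_diff_left) simp
    qed
    ultimately show ?thesis by (simp add: dist_norm norm_eq)
  qed
  ultimately show ?thesis by (simp add: isometry_group_def)
qed

end

theory Submission
  imports Defs
begin

text \<open>
  Let \<open>C\<close> be the closure of the orbit of \<open>V\<close>. A rotation of infinite order turns by an irrational
  multiple of a full turn, so by Kronecker's approximation theorem its powers are dense among all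
  rotations about the same centre or axis; as \<open>C\<close> is closed, it is mapped into itself by every
  rotation about the two centres or axes (\<open>closure_orbit_invariant_all_angles\<close>).

  It then suffices to find a single nonzero vector \<open>w\<close> whose translation maps \<open>C\<close> into itself. The set
  \<open>T\<close> of all vectors whose translation maps \<open>C\<close> into itself is closed under addition and, by conjugation, under the linear parts of the
  rotations preserving \<open>C\<close>. Hence with \<open>w\<close> it contains a whole circle of vectors in the plane of
  rotation, and the sums of vectors of a circle fill that plane
  (\<open>subspace_subset_if_sphere_subset\<close>).

  In the plane, \<open>w\<close> comes from the composition of the half-turns about \<open>U1\<close> and \<open>U2\<close>, which is the
  translation by \<open>2 (U2 - U1)\<close>.

  In space, call a line an axis of \<open>C\<close> if all rotations about it map \<open>C\<close> into itself. Rotating one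
  axis of \<open>C\<close> about another gives an axis of \<open>C\<close> again. For axes through \<open>A\<close> and \<open>B\<close> with unit
  directions \<open>u\<close> and \<open>v\<close>, the triple product \<open>(B - A) \<bullet> (u \<times> v)\<close> is nonzero if the axes are
  skew. Replacing the second axis by the image of the first under the rotation by \<open>s\<close> about the
  second multiplies this triple product by \<open>2 (u \<bullet> v) (1 - cos s)\<close>
  (\<open>rotated_axis_determinant\<close>), so the two axes stay skew unless they were
  perpendicular or the rotation is trivial. Half-turns widen the angle between the axes until, after
  finitely many steps, some rotation makes them perpendicular (\<open>exists_perpendicular_axes\<close>).
  The composition of the half-turns about two perpendicular skew axes is a screw motion by a straight
  angle along their common perpendicular, so its square is a translation by a nonzero vector \<open>w\<close>. As
  \<open>w\<close> is orthogonal to both axes, \<open>T\<close> contains the two planes orthogonal to them, and these span the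
  space.
\<close>

section \<open>Closed sets invariant under a rotation of infinite order\<close>

text \<open>
  The family \<open>\<rho>\<close> is any continuous action of the real line of period \<open>2 \<pi>\<close>; it is later the family
  of rotations about a point of the plane or about a line in space.
\<close>

lemma closed_invariant_all_angles:
  fixes \<rho> :: "real \<Rightarrow> 'a::metric_space \<Rightarrow> 'a"
  assumes add: "\<And>s t x. \<rho> (s + t) x = \<rho> s (\<rho> t x)"
    and full: "\<And>x. \<rho> (2 * pi) x = x"
    and cont: "\<And>x. continuous_on UNIV (\<lambda>s. \<rho> s x)"
    and iso: "\<rho> t \<in> carrier isometry_group"
    and inf: "infinite_order (\<rho> t)"
    and C: "closed C" "\<rho> t ` C \<subseteq> C" "x \<in> C"
  shows "\<rho> s x \<in> C"
proof -
  have zero: "\<rho> 0 x = x" for x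
    using add[of "2 * pi" 0 x] full by simp
  have mult: "\<rho> (real n * a) = \<rho> a ^^ n" for n a
  proof (induction n)
    case 0 then show ?case by (auto simp: zero)
  next
    case (Suc n)
    have "\<rho> (real (Suc n) * a) y = \<rho> a (\<rho> (real n * a) y)" for y
      by (simp add: add[symmetric] algebra_simps)
    then show ?case using Suc by (auto simp: fun_eq_iff)
  qed
  have nper: "\<rho> (2 * pi * real n) = (\<lambda>x. x)" for n
  proof -
    have "(\<rho> (2 * pi) ^^ n) y = y" for y by (induction n) (auto simp: full)
    then show ?thesis using mult[of n "2 * pi"] by (auto simp: fun_eq_iff mult.commute)
  qed
  have per: "\<rho> (2 * pi * of_int k) = (\<lambda>x. x)" for k :: int
  proof (cases k rule: int_cases2)
    case (nonneg n) then show ?thesis using nper[of n] by simp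
  next
    case (nonpos n)
    have "y = \<rho> (2 * pi * of_int k) (\<rho> (2 * pi * real n) y)" for y
      using zero nonpos by (simp add: add[symmetric])
    then show ?thesis by (auto simp: nper fun_eq_iff)
  qed
  define \<theta> where "\<theta> = t / (2 * pi)"
  have t: "t = 2 * pi * \<theta>" by (simp add: \<theta>_def)
  \<comment> \<open>A rational multiple of a full turn would have finite order.\<close>
  have irr: "\<theta> \<notin> \<rat>"
  proof
    assume "\<theta> \<in> \<rat>"
    then obtain a b :: int where b: "b > 0" "\<theta> = of_int a / of_int b"
      by (metis Rats_cases')
    then have "real (nat b) * t = 2 * pi * of_int a" by (simp add: t)
    then have "\<rho> t ^^ nat b = (\<lambda>x. x)" using mult[of "nat b" t] per[of a] by simp
    then show False using inf b(1) by (simp add: infinite_order_iff[OF iso])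
  qed
  \<comment> \<open>The admissible angles, measured in full turns.\<close>
  define A where "A = {a. \<rho> (2 * pi * a) x \<in> C}"
  have "continuous_on UNIV (\<lambda>a. \<rho> (2 * pi * a) x)"
    by (rule continuous_on_compose2[OF cont]) (auto intro!: continuous_intros)
  then have clA: "closed A"
    unfolding A_def using closed_vimage[OF C(1)] by (simp add: vimage_def)
  have "frac (real n * \<theta>) \<in> A" for n
  proof -
    have "(\<rho> t ^^ n) x \<in> C" using C by (induction n) auto
    then have "\<rho> (real n * t) x \<in> C" by (simp add: mult)
    moreover have "2 * pi * frac (real n * \<theta>) = real n * t + 2 * pi * of_int (- \<lfloor>real n * \<theta>\<rfloor>)"
      by (simp add: frac_def t algebra_simps)
    ultimately show ?thesis by (simp only: A_def mem_Collect_eq add per)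
  qed
  then have "closure (range (\<lambda>n. frac (real n * \<theta>))) \<subseteq> A"
    using clA by (intro closure_minimal) auto
  then have "frac (s / (2 * pi)) \<in> A"
    unfolding Kronecker_approx_1[OF irr] by (auto simp: frac_lt_1 less_imp_le)
  moreover have "s = 2 * pi * frac (s / (2 * pi)) + 2 * pi * of_int \<lfloor>s / (2 * pi)\<rfloor>"
    by (simp add: frac_def algebra_simps)
  ultimately show ?thesis by (metis (lifting) A_def add mem_Collect_eq per)
qed

lemma closure_orbit_invariant:
  assumes "r \<in> R" "R \<subseteq> carrier isometry_group"
  shows "r ` closure (orbit_of V (stationary_group R)) \<subseteq> closure (orbit_of V (stationary_group R))"
proof -
  let ?O = "orbit_of V (stationary_group R)"
  have d: "dist (r x) (r y) = dist x y" for x y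
    using assms by (auto simp: isometry_group_def)
  have "continuous_on UNIV r"
    unfolding continuous_on_iff by (metis d)
  moreover have "r ` ?O \<subseteq> ?O"
  proof
    fix y assume "y \<in> r ` ?O"
    then obtain f where f: "f \<in> generate isometry_group R" "y = r (f V)"
      by (auto simp: orbit_of_def stationary_group_def)
    then have "f \<otimes>\<^bsub>isometry_group\<^esub> r \<in> generate isometry_group R"
      using assms(1) by (intro generate.eng) (auto intro: generate.incl)
    then show "y \<in> ?O"
      using f(2) by (force simp: orbit_of_def stationary_group_def isometry_group_def)
  qed
  ultimately show ?thesis
    by (intro image_closure_subset) (auto intro: continuous_on_subset closure_subset[THEN subsetD])
qed

lemma orbit_of_nonempty: "orbit_of V (stationary_group R) \<noteq> {}"
  using generate.one[of isometry_group R] by (auto simp: orbit_of_def stationary_group_def)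

lemma closure_orbit_invariant_all_angles:
  fixes \<rho> :: "real \<Rightarrow> 'a::metric_space \<Rightarrow> 'a"
  assumes "\<And>s t x. \<rho> (s + t) x = \<rho> s (\<rho> t x)" "\<And>x. \<rho> (2 * pi) x = x"
    and "\<And>x. continuous_on UNIV (\<lambda>s. \<rho> s x)"
    and "\<rho> t \<in> R" "R \<subseteq> carrier isometry_group" "infinite_order (\<rho> t)"
    and "x \<in> closure (orbit_of V (stationary_group R))"
  shows "\<rho> s x \<in> closure (orbit_of V (stationary_group R))"
proof (rule closed_invariant_all_angles[where \<rho> = \<rho> and t = t])
  show "\<rho> t ` closure (orbit_of V (stationary_group R)) \<subseteq> closure (orbit_of V (stationary_group R))"
    using assms(4,5) by (rule closure_orbit_invariant)
qed (use assms in auto)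

section \<open>Translations mapping a set into itself\<close>

text \<open>
  The vectors whose translation maps \<open>C\<close> into, not necessarily onto, \<open>C\<close>; they form a monoid.
\<close>

definition translations_into :: "'a::ab_group_add set \<Rightarrow> 'a set" where
  "translations_into C = {v. \<forall>x\<in>C. x + v \<in> C}"

lemma translations_into_zero: "0 \<in> translations_into C"
  by (simp add: translations_into_def)

lemma translations_into_add:
  "v \<in> translations_into C \<Longrightarrow> w \<in> translations_into C \<Longrightarrow> v + w \<in> translations_into C"
  by (auto simp: translations_into_def add.assoc[symmetric])

lemma translations_into_conjugate:
  assumes v: "v \<in> translations_into C"
    and R: "\<And>x. x \<in> C \<Longrightarrow> R x \<in> C" "\<And>x. x \<in> C \<Longrightarrow> R' x \<in> C"
    and eq: "\<And>x. R (R' x + v) = x + w"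
  shows "w \<in> translations_into C"
  using v R by (auto simp: translations_into_def eq[symmetric])

lemma translations_into_UNIV:
  assumes "C \<noteq> {}" "translations_into C = UNIV"
  shows "C = UNIV"
proof -
  obtain x where x: "x \<in> C" using assms by blast
  have "y \<in> C" for y
  proof -
    have "y - x \<in> translations_into C" using assms by simp
    then have "x + (y - x) \<in> C" using x by (simp only: translations_into_def) blast
    then show ?thesis by simp
  qed
  then show ?thesis by blast
qed

text \<open>
  Every vector of norm at most \<open>2 * r\<close> in \<open>P\<close> is a sum of two vectors of norm \<open>r\<close> in \<open>P\<close>, because it is
  the base of an isosceles triangle with legs \<open>r\<close>; longer vectors are integer multiples of short ones. The
  assumption on orthogonal vectors says that \<open>P\<close> has dimension at least two.
\<close>

lemma subspace_subset_if_sphere_subset: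
  fixes P T :: "'a::real_inner set"
  assumes zero: "0 \<in> T" and add: "\<And>v w. v \<in> T \<Longrightarrow> w \<in> T \<Longrightarrow> v + w \<in> T"
    and P: "subspace P" and perp: "\<And>y. y \<in> P \<Longrightarrow> \<exists>z\<in>P. z \<noteq> 0 \<and> z \<bullet> y = 0"
    and r: "r > 0" and sphere: "\<And>p. p \<in> P \<Longrightarrow> norm p = r \<Longrightarrow> p \<in> T"
  shows "P \<subseteq> T"
proof
  fix y assume y: "y \<in> P"
  have small: "q \<in> T" if q: "q \<in> P" "norm q \<le> 2 * r" for q
  proof -
    obtain z where z: "z \<in> P" "z \<noteq> 0" "z \<bullet> q = 0" using perp[OF q(1)] by blast
    \<comment> \<open>\<open>q / 2 + h z\<close> and \<open>q / 2 - h z\<close> are the two legs.\<close>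
    define h where "h = sqrt (r\<^sup>2 - (norm q)\<^sup>2 / 4) / norm z"
    have h: "h\<^sup>2 * (norm z)\<^sup>2 = r\<^sup>2 - (norm q)\<^sup>2 / 4"
    proof -
      have "(norm q)\<^sup>2 \<le> (2 * r)\<^sup>2" using q(2) by (intro power_mono) auto
      then show ?thesis using z(2) by (simp add: h_def power_divide power_mult_distrib)
    qed
    have n: "norm ((1/2) *\<^sub>R q + e *\<^sub>R z) = r" if "e\<^sup>2 = h\<^sup>2" for e
    proof -
      have "(norm ((1/2) *\<^sub>R q + e *\<^sub>R z))\<^sup>2 = (norm q)\<^sup>2 / 4 + e\<^sup>2 * (norm z)\<^sup>2"
        unfolding power2_norm_eq_inner using z(3)
        by (simp add: inner_add_left inner_add_right inner_commute[of q z] power2_eq_square)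
      then have "(norm ((1/2) *\<^sub>R q + e *\<^sub>R z))\<^sup>2 = r\<^sup>2" using that h by simp
      then show ?thesis using r by (simp add: power2_eq_iff_nonneg)
    qed
    have "(1/2) *\<^sub>R q + e *\<^sub>R z \<in> T" if "e\<^sup>2 = h\<^sup>2" for e
      using P q z n[OF that] by (intro sphere) (auto intro!: subspace_add subspace_scale)
    from add[OF this[of h] this[of "- h"]] show ?thesis
      by (simp add: scaleR_left_distrib[symmetric])
  qed
  obtain n :: nat where n: "norm y / (2 * r) < real n" using reals_Archimedean2 by blast
  then have npos: "real n > 0" using r by (smt (verit) divide_nonneg_pos norm_ge_zero)
  define q where "q = (1 / real n) *\<^sub>R y"
  have "norm q \<le> 2 * r"
    using n npos r by (simp add: q_def field_simps)
  then have q: "q \<in> T" using y P by (intro small) (auto simp: q_def intro: subspace_scale)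
  have "real m *\<^sub>R q \<in> T" for m
    by (induction m) (auto simp: zero scaleR_left_distrib intro: add q)
  from this[of n] show "y \<in> T" using npos by (simp add: q_def)
qed

section \<open>Rotations of the plane\<close>

lemma rotation2_add_angle: "rotation2 U (s + t) x = rotation2 U s (rotation2 U t x)"
  by (simp add: rotation2_def vec_eq_iff forall_2 cos_add sin_add algebra_simps)

text \<open>
  The rotation about the origin is the linear part of the rotation by the same angle about any point.
\<close>

lemma rotation2_transitive_on_circle:
  assumes "norm a = norm b"
  shows "\<exists>t. b = rotation2 0 t a"
proof (cases "a = 0")
  case True
  then have "b = 0" using assms by simp
  then show ?thesis using True by (intro exI[of _ 0]) (simp add: rotation2_def vec_eq_iff forall_2)
next
  case False
  define q where "q = (a$1)\<^sup>2 + (a$2)\<^sup>2"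
  have q: "q \<noteq> 0" using False by (simp add: q_def vec_eq_iff forall_2 sum_power2_eq_zero_iff)
  have b: "(b$1)\<^sup>2 + (b$2)\<^sup>2 = q"
    using assms by (simp add: q_def norm_vec_def L2_set_def sum_2)
  define p where "p = (a$1 * b$1 + a$2 * b$2) / q"
  define r where "r = (a$1 * b$2 - a$2 * b$1) / q"
  have "(a$1 * b$1 + a$2 * b$2)\<^sup>2 + (a$1 * b$2 - a$2 * b$1)\<^sup>2
      = ((a$1)\<^sup>2 + (a$2)\<^sup>2) * ((b$1)\<^sup>2 + (b$2)\<^sup>2)"
    by (simp add: power2_eq_square algebra_simps)
  then have "p\<^sup>2 + r\<^sup>2 = 1"
    using q unfolding b q_def[symmetric]
    by (simp add: p_def r_def power_divide power2_eq_square flip: add_divide_distrib)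
  then obtain t where t: "p = cos t" "r = sin t" using sincos_total_2pi by metis
  have qp: "q * p = a$1 * b$1 + a$2 * b$2" and qr: "q * r = a$1 * b$2 - a$2 * b$1"
    using q by (simp_all add: p_def r_def)
  have "q * (p * a$1 - r * a$2) = (q * p) * a$1 - (q * r) * a$2"
    "q * (r * a$1 + p * a$2) = (q * r) * a$1 + (q * p) * a$2"
    by (simp_all add: algebra_simps)
  then have "q * (p * a$1 - r * a$2) = q * b$1" "q * (r * a$1 + p * a$2) = q * b$2"
    unfolding qp qr by (simp_all add: q_def power2_eq_square algebra_simps)
  then have "b = rotation2 0 t a"
    using q t by (simp add: rotation2_def vec_eq_iff forall_2)
  then show ?thesis ..
qed

lemma orbit_dense_plane:
  assumes U: "U1 \<noteq> U2"
    and inf: "infinite_order (rotation2 U1 t1)" "infinite_order (rotation2 U2 t2)"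
  shows "closure (orbit_of V (stationary_group {rotation2 U1 t1, rotation2 U2 t2})) = UNIV"
proof -
  define C where "C = closure (orbit_of V (stationary_group {rotation2 U1 t1, rotation2 U2 t2}))"
  have cont: "continuous_on UNIV (\<lambda>s. rotation2 U s x)" for U x
  proof -
    have "rotation2 U s x
        = U + cos s *\<^sub>R (x - U) + sin s *\<^sub>R vector [- (x - U)$2, (x - U)$1]" for s
      by (simp add: rotation2_def vec_eq_iff forall_2 algebra_simps)
    then show ?thesis by (auto intro!: continuous_intros)
  qed
  have inv: "rotation2 U s x \<in> C" if x: "x \<in> C" and U: "U \<in> {U1, U2}" for U s x
  proof -
    obtain t where t: "(U, t) \<in> {(U1, t1), (U2, t2)}" using U by blast
    show ?thesis
      unfolding C_def
    proof (rule closure_orbit_invariant_all_angles[where \<rho> = "rotation2 U" and t = t])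
      show "rotation2 U (2 * pi) y = y" for y
        by (simp add: rotation2_def vec_eq_iff forall_2)
    qed (use x t inf in \<open>auto simp: C_def cont rotation2_add_angle rotation2_isometry\<close>)
  qed
  define w where "w = 2 *\<^sub>R (U2 - U1)"
  have "rotation2 U2 pi (rotation2 U1 pi x) = x + w" for x
    by (simp add: rotation2_def w_def vec_eq_iff forall_2)
  moreover have "rotation2 U2 pi (rotation2 U1 pi x) \<in> C" if "x \<in> C" for x
    using inv that by blast
  ultimately have w: "w \<in> translations_into C" "w \<noteq> 0"
    using U by (auto simp: translations_into_def w_def)
  have "UNIV \<subseteq> translations_into C"
  proof (rule subspace_subset_if_sphere_subset[where r = "norm w"])
    fix y :: "real^2"
    show "\<exists>z\<in>UNIV. z \<noteq> 0 \<and> z \<bullet> y = 0"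
    proof (cases "y = 0")
      case True then show ?thesis using w(2) by (intro bexI[of _ w]) auto
    next
      case False
      then show ?thesis
        by (intro bexI[of _ "vector [- y$2, y$1]"]) (auto simp: vec_eq_iff forall_2 inner_vec_def sum_2)
    qed
  next
    fix p :: "real^2" assume "norm p = norm w"
    then obtain t where t: "p = rotation2 0 t w" using rotation2_transitive_on_circle by metis
    have "rotation2 U1 t (rotation2 U1 (- t) x + w) = rotation2 U1 t (rotation2 U1 (- t) x) + p" for x
      by (simp add: t rotation2_def vec_eq_iff forall_2 algebra_simps)
    moreover have "rotation2 U1 t (rotation2 U1 (- t) x) = x" for x
      using rotation2_add_angle[of U1 t "- t" x] by (simp add: rotation2_def vec_eq_iff forall_2)
    ultimately have "rotation2 U1 t (rotation2 U1 (- t) x + w) = x + p" for x by simp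
    then show "p \<in> translations_into C"
      using inv w(1)
      by - (rule translations_into_conjugate[of w C "rotation2 U1 t" "rotation2 U1 (- t)"],
        auto)
  qed (use w in \<open>auto intro: translations_into_zero translations_into_add\<close>)
  then show ?thesis
    using translations_into_UNIV[of C] by (auto simp: C_def orbit_of_nonempty)
qed

section \<open>Linear rotations of space\<close>

text \<open>
  The linear part of \<open>rotation3 A u t\<close>. It is a rotation when \<open>u\<close> is a unit vector.
\<close>

definition rodrigues :: "real^3 \<Rightarrow> real \<Rightarrow> real^3 \<Rightarrow> real^3" where
  "rodrigues u t v = cos t *\<^sub>R v + sin t *\<^sub>R cross3 u v + ((1 - cos t) * (u \<bullet> v)) *\<^sub>R u"

lemma rotation3_eq_rodrigues: "rotation3 A u t P = A + rodrigues u t (P - A)"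
  by (simp add: rotation3_def rodrigues_def)

lemma linear_rodrigues: "linear (rodrigues u t)"
  by (rule linearI) (simp_all add: rodrigues_def inner_add_right cross_add_right cross_mult_right
      algebra_simps)

lemma rodrigues_add_angle:
  assumes "norm u = 1"
  shows "rodrigues u (s + t) v = rodrigues u s (rodrigues u t v)"
proof -
  have uu: "u \<bullet> u = 1" using assms by (simp add: norm_eq_1)
  have inner: "u \<bullet> rodrigues u t v = u \<bullet> v"
    by (simp add: rodrigues_def inner_add_right uu dot_cross_self algebra_simps)
  have uuv: "cross3 u (cross3 u v) = (u \<bullet> v) *\<^sub>R u - v"
    using Lagrange[of u u v] uu by simp
  have cross: "cross3 u (rodrigues u t v) = cos t *\<^sub>R cross3 u v + sin t *\<^sub>R ((u \<bullet> v) *\<^sub>R u - v)"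
    by (simp add: rodrigues_def cross_add_right cross_mult_right uuv)
  have "rodrigues u s (rodrigues u t v) = cos s *\<^sub>R rodrigues u t v
      + sin s *\<^sub>R cross3 u (rodrigues u t v) + ((1 - cos s) * (u \<bullet> rodrigues u t v)) *\<^sub>R u"
    by (simp add: rodrigues_def)
  also have "\<dots> = rodrigues u (s + t) v"
    unfolding inner cross unfolding rodrigues_def cos_add sin_add
    by (simp add: algebra_simps)
  finally show ?thesis by simp
qed

lemma rodrigues_zero: "rodrigues u 0 v = v"
  by (simp add: rodrigues_def)

lemma orthogonal_transformation_rodrigues:
  assumes "norm u = 1"
  shows "orthogonal_transformation (rodrigues u t)"
proof -
  have "dist (rotation3 0 u t x) (rotation3 0 u t 0) = dist x 0" for x
    using rotation3_isometry[OF assms, of 0 t] by (simp add: isometry_group_def)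
  then have "norm (rodrigues u t x) = norm x" for x
    by (simp add: rotation3_eq_rodrigues linear_0[OF linear_rodrigues])
  then show ?thesis by (simp add: orthogonal_transformation linear_rodrigues)
qed

text \<open>
  A rotation is the square of the rotation by half the angle, so its determinant is the square of
  a number equal to \<open>1\<close> or \<open>-1\<close>.
\<close>

lemma det_rodrigues:
  assumes "norm u = 1"
  shows "det (matrix (rodrigues u t)) = 1"
proof -
  have "rodrigues u t = rodrigues u (t / 2) \<circ> rodrigues u (t / 2)"
    using rodrigues_add_angle[OF assms, of "t / 2" "t / 2"] by (auto simp: fun_eq_iff)
  then have "det (matrix (rodrigues u t)) = (det (matrix (rodrigues u (t / 2))))\<^sup>2"
    by (metis det_mul linear_rodrigues matrix_compose power2_eq_square)
  also have "\<dots> = 1"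
    using orthogonal_transformation_det[OF orthogonal_transformation_rodrigues[OF assms]]
    by (metis power2_abs power_one)
  finally show ?thesis .
qed

lemma cross3_rodrigues:
  assumes "norm u = 1"
  shows "cross3 (rodrigues u t x) (rodrigues u t y) = rodrigues u t (cross3 x y)"
  using cross_orthogonal_transformation[OF orthogonal_transformation_rodrigues[OF assms]]
  by (simp add: det_rodrigues[OF assms])

lemma inner_rodrigues:
  assumes "norm u = 1"
  shows "rodrigues u t x \<bullet> rodrigues u t y = x \<bullet> y"
  using orthogonal_transformation_rodrigues[OF assms] by (simp add: orthogonal_transformation_def)

text \<open>
  Conjugating a rotation by a second one yields the rotation by the same angle about the rotated
  direction.
\<close>

lemma rodrigues_conjugate:
  assumes "norm v = 1"
  shows "rodrigues (rodrigues v s u) t (rodrigues v s x) = rodrigues v s (rodrigues u t x)"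
proof -
  note L = linear_rodrigues[of v s]
  have "rodrigues v s (rodrigues u t x) = cos t *\<^sub>R rodrigues v s x
      + sin t *\<^sub>R rodrigues v s (cross3 u x) + ((1 - cos t) * (u \<bullet> x)) *\<^sub>R rodrigues v s u"
    unfolding rodrigues_def[of u t x] by (simp only: linear_add[OF L] linear_scale[OF L])
  then show ?thesis
    by (simp add: rodrigues_def[of "rodrigues v s u"] cross3_rodrigues[OF assms]
        inner_rodrigues[OF assms])
qed

lemma cross3_orthogonal_eq_0:
  fixes x y z :: "real^3"
  assumes "cross3 x y \<noteq> 0" "x \<bullet> z = 0" "y \<bullet> z = 0" "cross3 x y \<bullet> z = 0"
  shows "z = 0"
proof -
  have "cross3 z (cross3 x y) = (y \<bullet> z) *\<^sub>R x - (x \<bullet> z) *\<^sub>R y"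
    by (simp add: Lagrange inner_commute)
  then have "cross3 (cross3 x y) z = 0"
    using assms(2,3) cross_skew[of z "cross3 x y"] by simp
  then show ?thesis using norm_and_cross_eq_0[of "cross3 x y" z] assms by simp
qed

lemma rodrigues_transitive_on_circle:
  assumes u: "norm u = 1" and a: "u \<bullet> a = 0" and b: "u \<bullet> b = 0" and ab: "norm a = norm b"
  shows "\<exists>t. b = rodrigues u t a"
proof (cases "a = 0")
  case True
  then have "b = 0" using ab by simp
  then show ?thesis using True by (metis rodrigues_zero)
next
  case False
  have uu: "u \<bullet> u = 1" using u by (simp add: norm_eq_1)
  define q where "q = a \<bullet> a"
  define p where "p = a \<bullet> b / q"
  define r where "r = cross3 u a \<bullet> b / q"
  have q: "q \<noteq> 0" using False by (simp add: q_def)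
  have bb: "b \<bullet> b = q" using ab by (simp add: q_def norm_eq)
  have cc: "cross3 u a \<bullet> cross3 u a = q"
    by (simp add: dot_cross uu a inner_commute[of a u] q_def)
  have eq: "b = p *\<^sub>R a + r *\<^sub>R cross3 u a"
  proof -
    have "b - (p *\<^sub>R a + r *\<^sub>R cross3 u a) = 0"
    proof (rule cross3_orthogonal_eq_0[of u a])
      show "cross3 u a \<noteq> 0" using cc q by auto
      show "u \<bullet> (b - (p *\<^sub>R a + r *\<^sub>R cross3 u a)) = 0"
        by (simp add: inner_diff_right inner_add_right a b dot_cross_self)
      show "a \<bullet> (b - (p *\<^sub>R a + r *\<^sub>R cross3 u a)) = 0"
        using q by (simp add: inner_diff_right inner_add_right dot_cross_self p_def flip: q_def)
      show "cross3 u a \<bullet> (b - (p *\<^sub>R a + r *\<^sub>R cross3 u a)) = 0"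
        using q by (simp add: inner_diff_right inner_add_right dot_cross_self r_def cc)
    qed
    then show ?thesis by simp
  qed
  have "b \<bullet> b = p * (a \<bullet> b) + r * (cross3 u a \<bullet> b)"
    by (subst eq) (simp add: inner_add_left)
  also have "\<dots> = q * (p\<^sup>2 + r\<^sup>2)"
    using q by (simp add: p_def r_def power2_eq_square add_divide_distrib distrib_left)
  finally have "p\<^sup>2 + r\<^sup>2 = 1"
    using q bb by simp
  then obtain t where "p = cos t" "r = sin t" using sincos_total_2pi by metis
  then show ?thesis using eq by (auto simp: rodrigues_def a)
qed

section \<open>Axes of an invariant set\<close>

text \<open>
  The line through \<open>A\<close> with unit direction \<open>u\<close> is an axis of \<open>C\<close> if the rotations about it by all
  angles map \<open>C\<close> into itself.
\<close>

definition full_axis :: "(real^3) set \<Rightarrow> real^3 \<Rightarrow> real^3 \<Rightarrow> bool" where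
  "full_axis C A u \<longleftrightarrow> norm u = 1 \<and> (\<forall>t. \<forall>x\<in>C. rotation3 A u t x \<in> C)"

lemma full_axis_rotate:
  assumes v: "full_axis C B v" and u: "full_axis C A u"
  shows "full_axis C (rotation3 B v s A) (rodrigues v s u)"
proof -
  have nv: "norm v = 1" using v by (simp add: full_axis_def)
  have "norm (rodrigues v s u) = 1"
    using u orthogonal_transformation_rodrigues[OF nv]
    by (simp add: full_axis_def orthogonal_transformation)
  moreover have "rotation3 (rotation3 B v s A) (rodrigues v s u) t x \<in> C" if "x \<in> C" for t x
  proof -
    define y where "y = rotation3 B v (- s) x"
    have y: "y \<in> C" using v that by (simp add: full_axis_def y_def)
    have x: "x = rotation3 B v s y"
      using rodrigues_add_angle[OF nv, of s "- s"]
      by (simp add: y_def rotation3_eq_rodrigues rodrigues_zero)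
    note L = linear_rodrigues[of v s]
    have "x - rotation3 B v s A = rodrigues v s (y - A)"
      by (simp add: x rotation3_eq_rodrigues flip: linear_diff[OF L])
    then have "rotation3 (rotation3 B v s A) (rodrigues v s u) t x
        = rotation3 B v s A + rodrigues v s (rodrigues u t (y - A))"
      by (simp add: rotation3_eq_rodrigues[of "rotation3 B v s A"] rodrigues_conjugate[OF nv])
    also have "\<dots> = rotation3 B v s (rotation3 A u t y)"
      by (simp add: rotation3_eq_rodrigues algebra_simps flip: linear_add[OF L])
    finally show ?thesis using u v y by (simp add: full_axis_def)
  qed
  ultimately show ?thesis by (simp add: full_axis_def)
qed

lemma inner_rodrigues_self:
  assumes "norm u = 1" "norm v = 1"
  shows "u \<bullet> rodrigues v s u = (u \<bullet> v)\<^sup>2 + (1 - (u \<bullet> v)\<^sup>2) * cos s"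
  using assms by (simp add: rodrigues_def inner_add_right dot_cross_self norm_eq_1 inner_commute[of v u]
      power2_eq_square algebra_simps)

text \<open>
  The triple product measures how far two lines are from being coplanar. It survives the passage
  to a rotated axis up to a factor that vanishes only if the axes are perpendicular or \<open>cos s = 1\<close>.
\<close>

lemma rotated_axis_determinant:
  assumes u: "norm u = 1" and v: "norm v = 1"
  shows "(rotation3 B v s A - A) \<bullet> cross3 u (rodrigues v s u)
       = 2 * (u \<bullet> v) * (1 - cos s) * ((B - A) \<bullet> cross3 u v)"
proof -
  define D where "D = A - B"
  define c where "c = u \<bullet> v"
  define e where "e = D \<bullet> cross3 u v"
  define k where "k = 1 - cos s"
  define w where "w = cross3 u (rodrigues v s u)"
  have uu: "u \<bullet> u = 1" "v \<bullet> v = 1" using u v by (simp_all add: norm_eq_1)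
  have vu: "v \<bullet> u = c" by (simp add: c_def inner_commute)
  have w: "w = sin s *\<^sub>R (v - c *\<^sub>R u) + (k * c) *\<^sub>R cross3 u v"
    by (simp add: w_def rodrigues_def cross_add_right cross_mult_right Lagrange uu vu k_def
        flip: c_def)
  have D: "rotation3 B v s A - A = sin s *\<^sub>R cross3 v D + k *\<^sub>R ((v \<bullet> D) *\<^sub>R v - D)"
    by (simp add: rotation3_eq_rodrigues rodrigues_def D_def k_def algebra_simps)
  have 1: "cross3 v D \<bullet> v = 0" by (simp add: dot_cross_self)
  have 2: "cross3 v D \<bullet> u = e"
    by (simp add: e_def cross3_simps)
  have 3: "cross3 v D \<bullet> cross3 u v = c * (v \<bullet> D) - u \<bullet> D"
    by (simp add: dot_cross uu vu inner_commute[of D v] inner_commute[of D u])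
  have 4: "v \<bullet> cross3 u v = 0" by (simp add: dot_cross_self)
  have "(rotation3 B v s A - A) \<bullet> w = - c * e * ((sin s)\<^sup>2 + k\<^sup>2)"
    unfolding w D
    by (simp add: inner_add_left inner_add_right inner_diff_left inner_diff_right 1 2 3 4 uu vu
        e_def[symmetric] inner_commute[of D v] inner_commute[of D u] power2_eq_square algebra_simps)
  also have "(sin s)\<^sup>2 + k\<^sup>2 = 2 * k"
    using sin_cos_squared_add[of s] by (simp add: k_def power2_eq_square algebra_simps)
  finally show ?thesis
    by (simp add: w_def c_def k_def e_def D_def inner_diff_left algebra_simps)
qed

text \<open>
  If \<open>u\<close> makes an angle between 45 and 135 degrees with \<open>v\<close>, then some rotation about \<open>v\<close> makes \<open>u\<close>
  perpendicular to its original direction. Otherwise, replacing the second axis by the image of the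
  first under the half-turn about the second at least doubles the squared sine \<open>1 - (u \<bullet> v)\<^sup>2\<close> of the
  angle, which is bounded by \<open>1\<close>; the exponent \<open>n\<close> bounds the number of half-turns left.
\<close>

lemma exists_perpendicular_axes_aux:
  assumes "full_axis C A u" "full_axis C B v" "(B - A) \<bullet> cross3 u v \<noteq> 0"
    and "1 - (u \<bullet> v)\<^sup>2 \<ge> (1 / 2) ^ n"
  shows "\<exists>A' u' B' v'. full_axis C A' u' \<and> full_axis C B' v' \<and> u' \<bullet> v' = 0 \<and>
           (B' - A') \<bullet> cross3 u' v' \<noteq> 0"
  using assms
proof (induction n arbitrary: B v)
  case 0
  then have "u \<bullet> v = 0" by simp
  then show ?case using "0.prems" by blast
next
  case (Suc n)
  have u: "norm u = 1" and v: "norm v = 1" using Suc.prems by (auto simp: full_axis_def)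
  let ?c = "u \<bullet> v"
  have ax: "full_axis C (rotation3 B v s A) (rodrigues v s u)" for s
    using full_axis_rotate Suc.prems by blast
  consider "?c = 0" | "?c \<noteq> 0" "?c\<^sup>2 \<le> 1 / 2" | "?c\<^sup>2 > 1 / 2" by linarith
  then show ?case
  proof cases
    case 1 then show ?thesis using Suc.prems by blast
  next
    case 2
    \<comment> \<open>The solution of \<open>?c\<^sup>2 + (1 - ?c\<^sup>2) * x = 0\<close>, which lies in \<open>[-1, 0]\<close> as \<open>?c\<^sup>2 \<le> 1 / 2\<close>.\<close>
    define x where "x = - (?c\<^sup>2 / (1 - ?c\<^sup>2))"
    have x: "- 1 \<le> x" "x \<le> 0" using 2 by (auto simp: x_def field_simps)
    define s where "s = arccos x"
    have s: "cos s = x" using x by (simp add: s_def)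
    have "u \<bullet> rodrigues v s u = 0"
      using 2 by (simp add: inner_rodrigues_self[OF u v] s x_def)
    moreover have "(rotation3 B v s A - A) \<bullet> cross3 u (rodrigues v s u) \<noteq> 0"
      unfolding rotated_axis_determinant[OF u v] using 2 Suc.prems(3) x s by simp
    ultimately show ?thesis using Suc.prems(1) ax by blast
  next
    case 3
    let ?v = "rodrigues v pi u"
    have c': "u \<bullet> ?v = 2 * ?c\<^sup>2 - 1"
      by (simp add: inner_rodrigues_self[OF u v])
    have pos: "1 - ?c\<^sup>2 \<ge> 0"
      using order_trans[OF zero_le_power[of "1 / 2 :: real" "Suc n"] Suc.prems(4)] by simp
    have "1 - (u \<bullet> ?v)\<^sup>2 = 4 * ?c\<^sup>2 * (1 - ?c\<^sup>2)"
      unfolding c' by (simp add: power2_eq_square algebra_simps)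
    also have "\<dots> \<ge> 2 * (1 - ?c\<^sup>2)"
      using 3 pos by (intro mult_right_mono) auto
    finally have "1 - (u \<bullet> ?v)\<^sup>2 \<ge> (1 / 2) ^ n" using Suc.prems(4) by simp
    moreover have "(rotation3 B v pi A - A) \<bullet> cross3 u ?v \<noteq> 0"
      unfolding rotated_axis_determinant[OF u v] using 3 Suc.prems(3) by auto
    ultimately show ?thesis using Suc.IH[OF Suc.prems(1) ax] by blast
  qed
qed

lemma exists_perpendicular_axes:
  assumes "full_axis C A u" "full_axis C B v" "(B - A) \<bullet> cross3 u v \<noteq> 0"
  obtains A' u' B' v' where "full_axis C A' u'" "full_axis C B' v'" "u' \<bullet> v' = 0"
    "(B' - A') \<bullet> cross3 u' v' \<noteq> 0"
proof -
  have "cross3 u v \<noteq> 0" using assms(3) by auto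
  then have "(norm (cross3 u v))\<^sup>2 > 0" by simp
  moreover have "(norm (cross3 u v))\<^sup>2 + (u \<bullet> v)\<^sup>2 = 1"
    using assms by (simp add: norm_cross_dot full_axis_def)
  ultimately have "1 - (u \<bullet> v)\<^sup>2 > 0" by linarith
  then obtain n where "(1 / 2) ^ n < 1 - (u \<bullet> v)\<^sup>2"
    using real_arch_pow_inv[of "1 - (u \<bullet> v)\<^sup>2" "1 / 2"] by auto
  then show thesis
    using exists_perpendicular_axes_aux[OF assms, of n] that by force
qed

text \<open>
  The linear part \<open>G\<close> of the composition of two half-turns about perpendicular directions is the
  half-turn about the third orthogonal direction, so it is an involution and the square of the composition
  is a translation. Its vector \<open>w\<close> is \<open>-4\<close> times the component of \<open>B - A\<close> orthogonal to both axes.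
\<close>

lemma half_turns_give_translation:
  assumes A: "full_axis C A u" and B: "full_axis C B v" and uv: "u \<bullet> v = 0"
  defines "w \<equiv> 4 *\<^sub>R ((u \<bullet> (B - A)) *\<^sub>R u + (v \<bullet> (B - A)) *\<^sub>R v - (B - A))"
  shows "w \<in> translations_into C"
proof -
  define f where "f = (\<lambda>x. rotation3 A u pi (rotation3 B v pi x))"
  have uu: "u \<bullet> u = 1" "v \<bullet> v = 1" "v \<bullet> u = 0"
    using A B uv by (simp_all add: full_axis_def norm_eq_1 inner_commute)
  define D where "D = B - A"
  define G where "G = (\<lambda>z. rodrigues u pi (rodrigues v pi z))"
  \<comment> \<open>The composition fixes \<open>B\<close> up to the shift \<open>k\<close>, hence its square shifts by \<open>k + G k\<close>.\<close>
  define k where "k = rodrigues u pi D - D"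
  have G: "G z = z - (2 * (u \<bullet> z)) *\<^sub>R u - (2 * (v \<bullet> z)) *\<^sub>R v" for z
    by (simp add: G_def rodrigues_def inner_diff_right inner_add_right uv)
  have inner_G: "u \<bullet> G z = - (u \<bullet> z)" "v \<bullet> G z = - (v \<bullet> z)" for z
    by (simp_all add: G inner_diff_right uu uv)
  have GG: "G (G z) = z" for z
    unfolding G[of "G z"] inner_G by (simp add: G)
  have G_add: "G (y + z) = G y + G z" for y z
    by (simp add: G_def linear_add[OF linear_rodrigues])
  have k: "k + G k = w"
  proof -
    have k: "k = (2 * (u \<bullet> D)) *\<^sub>R u - 2 *\<^sub>R D"
      by (simp add: k_def rodrigues_def vec_eq_iff)
    have "u \<bullet> k = 0" "v \<bullet> k = - 2 * (v \<bullet> D)"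
      unfolding k inner_diff_right inner_scaleR_right by (simp_all add: uu)
    then have "k + G k = (k + k) + (4 * (v \<bullet> D)) *\<^sub>R v"
      by (simp add: G)
    also have "\<dots> = w"
      by (simp add: k w_def vec_eq_iff algebra_simps flip: D_def)
    finally show ?thesis .
  qed
  have f: "f x = B + (k + G (x - B))" for x
  proof -
    have "rotation3 B v pi x - A = D + rodrigues v pi (x - B)"
      by (simp add: rotation3_eq_rodrigues D_def)
    then have "f x = A + (rodrigues u pi D + G (x - B))"
      unfolding f_def rotation3_eq_rodrigues[of A] by (simp add: G_def linear_add[OF linear_rodrigues])
    then show ?thesis by (simp add: k_def D_def)
  qed
  have "f (f x) = B + ((k + G k) + (x - B))" for x
    unfolding f[of "f x"] by (subst f[of x]) (simp add: G_add GG add.assoc)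
  then have "f (f x) = x + w" for x
    by (simp add: k)
  moreover have "f (f x) \<in> C" if "x \<in> C" for x
    using A B that by (simp add: f_def full_axis_def)
  ultimately show ?thesis by (simp add: translations_into_def)
qed

text \<open>
  The rotations about an axis of \<open>C\<close> carry \<open>w\<close> to all vectors of the same norm orthogonal to the axis,
  and these generate the orthogonal plane.
\<close>

lemma plane_translations:
  assumes A: "full_axis C A u" and w: "w \<in> translations_into C" "u \<bullet> w = 0" "w \<noteq> 0"
  shows "{y. u \<bullet> y = 0} \<subseteq> translations_into C"
proof (rule subspace_subset_if_sphere_subset[where r = "norm w"])
  have u: "norm u = 1" using A by (simp add: full_axis_def)
  show "subspace {y. u \<bullet> y = 0}" by (rule subspace_hyperplane)
  fix y assume y: "y \<in> {y. u \<bullet> y = 0}"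
  show "\<exists>z\<in>{y. u \<bullet> y = 0}. z \<noteq> 0 \<and> z \<bullet> y = 0"
  proof (cases "y = 0")
    case True then show ?thesis using w by (intro bexI[of _ w]) auto
  next
    case False
    then have "cross3 u y \<noteq> 0" using y u norm_and_cross_eq_0[of u y] by auto
    then show ?thesis by (intro bexI[of _ "cross3 u y"]) (auto simp: dot_cross_self)
  qed
next
  have u: "norm u = 1" using A by (simp add: full_axis_def)
  fix p assume p: "p \<in> {y. u \<bullet> y = 0}" "norm p = norm w"
  then obtain t where t: "p = rodrigues u t w"
    using rodrigues_transitive_on_circle[OF u, of w p] w by auto
  have "rotation3 A u t (rotation3 A u (- t) x + w) = x + p" for x
  proof -
    have "rotation3 A u t (rotation3 A u (- t) x + w)
        = A + rodrigues u t (rodrigues u (- t) (x - A) + w)"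
      by (simp add: rotation3_eq_rodrigues algebra_simps)
    also have "\<dots> = x + p"
      using rodrigues_add_angle[OF u, of t "- t" "x - A"]
      by (simp add: linear_add[OF linear_rodrigues] rodrigues_zero t)
    finally show ?thesis .
  qed
  then show "p \<in> translations_into C"
    using A w(1) by - (rule translations_into_conjugate[of w C "rotation3 A u t" "rotation3 A u (- t)"],
        auto simp: full_axis_def)
qed (use w in \<open>auto intro: translations_into_zero translations_into_add\<close>)

lemma full_axes_imp_UNIV:
  assumes C: "C \<noteq> {}" and ax: "full_axis C A u" "full_axis C B v"
    and det: "(B - A) \<bullet> cross3 u v \<noteq> 0"
  shows "C = UNIV"
proof -
  \<comment> \<open>Perpendicular axes replace the given ones and take over their names.\<close>
  obtain A u B v where A: "full_axis C A u" and B: "full_axis C B v" and uv: "u \<bullet> v = 0"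
    and det: "(B - A) \<bullet> cross3 u v \<noteq> 0"
    using exists_perpendicular_axes[OF ax det] by metis
  define w where "w = 4 *\<^sub>R ((u \<bullet> (B - A)) *\<^sub>R u + (v \<bullet> (B - A)) *\<^sub>R v - (B - A))"
  have uu: "u \<bullet> u = 1" "v \<bullet> v = 1" "v \<bullet> u = 0"
    using A B uv by (simp_all add: full_axis_def norm_eq_1 inner_commute)
  have w: "w \<in> translations_into C"
    unfolding w_def by (rule half_turns_give_translation[OF A B uv])
  have "w \<bullet> cross3 u v = - 4 * ((B - A) \<bullet> cross3 u v)"
    by (simp add: w_def inner_add_left inner_diff_left dot_cross_self algebra_simps)
  then have w0: "w \<noteq> 0" using det by auto
  have perp: "u \<bullet> w = 0" "v \<bullet> w = 0"
    by (simp_all add: w_def inner_add_right inner_diff_right uu uv)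
  have "y \<in> translations_into C" for y
  proof -
    have "y - (u \<bullet> y) *\<^sub>R u \<in> translations_into C"
      using plane_translations[OF A w perp(1) w0] by (auto simp: inner_diff_right uu)
    moreover have "(u \<bullet> y) *\<^sub>R u \<in> translations_into C"
      using plane_translations[OF B w perp(2) w0] by (auto simp: uu)
    ultimately show ?thesis using translations_into_add by fastforce
  qed
  then show ?thesis using translations_into_UNIV[OF C] by blast
qed

section \<open>Orbits under rotations about skew lines\<close>

lemma full_axis_closure_orbit:
  assumes "norm u = 1" "rotation3 A u t \<in> R" "R \<subseteq> carrier isometry_group"
    and "infinite_order (rotation3 A u t)"
  shows "full_axis (closure (orbit_of V (stationary_group R))) A u"
  unfolding full_axis_def
proof (intro conjI allI ballI)
  fix s x assume x: "x \<in> closure (orbit_of V (stationary_group R))"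
  show "rotation3 A u s x \<in> closure (orbit_of V (stationary_group R))"
  proof (rule closure_orbit_invariant_all_angles[where \<rho> = "rotation3 A u" and t = t])
    show "rotation3 A u (s' + t') y = rotation3 A u s' (rotation3 A u t' y)" for s' t' y
      by (simp add: rotation3_eq_rodrigues rodrigues_add_angle[OF assms(1)])
    show "rotation3 A u (2 * pi) y = y" for y
      by (simp add: rotation3_def)
    show "continuous_on UNIV (\<lambda>s. rotation3 A u s y)" for y
      unfolding rotation3_def by (intro continuous_intros)
  qed (use assms x in auto)
qed fact

text \<open>
  If the triple product vanishes, the lines are parallel or lie in a common plane, where they intersect.
\<close>

lemma skew_imp_determinant_nonzero:
  assumes u: "norm u = 1" and v: "norm v = 1"
    and skew: "skew (line_through A u) (line_through B v)"
  shows "(B - A) \<bullet> cross3 u v \<noteq> 0"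
proof
  assume det: "(B - A) \<bullet> cross3 u v = 0"
  have uu: "u \<bullet> u = 1" "v \<bullet> v = 1" using u v by (simp_all add: norm_eq_1)
  show False
  proof (cases "cross3 u v = 0")
    case True
    define c where "c = u \<bullet> v"
    have "cross3 u (cross3 u v) = c *\<^sub>R u - v" by (simp add: Lagrange uu c_def)
    then have vc: "v = c *\<^sub>R u" using True by simp
    then have "c * c = 1" using uu by (metis inner_scaleR_left inner_scaleR_right mult.right_neutral)
    have "line_through B v = (\<lambda>x. (B - A) + x) ` line_through A u"
    proof (intro equalityI subsetI)
      fix x assume "x \<in> line_through B v"
      then obtain s where "x = B + s *\<^sub>R v" unfolding line_through_def by blast
      then have "x = (B - A) + (A + (s * c) *\<^sub>R u)" by (simp add: vc)
      then show "x \<in> (\<lambda>x. (B - A) + x) ` line_through A u" unfolding line_through_def by blast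
    next
      fix x assume "x \<in> (\<lambda>x. (B - A) + x) ` line_through A u"
      then obtain s where "x = (B - A) + (A + s *\<^sub>R u)" unfolding line_through_def by blast
      then have "x = B + (s * c) *\<^sub>R v" by (simp add: vc mult.assoc \<open>c * c = 1\<close>)
      then show "x \<in> line_through B v" unfolding line_through_def by blast
    qed
    then show False using skew unfolding skew_def affine_parallel_def by blast
  next
    case False
    define m where "m = cross3 u v"
    define D where "D = B - A"
    define a where "a = cross3 D v \<bullet> m / (m \<bullet> m)"
    define b where "b = cross3 u D \<bullet> m / (m \<bullet> m)"
    have m: "m \<bullet> m \<noteq> 0" using False by (simp add: m_def)
    \<comment> \<open>Cramer's rule for the basis \<open>u\<close>, \<open>v\<close>, \<open>m\<close>; the coefficient of \<open>m\<close> vanishes by \<open>det\<close>.\<close>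
    have "(m \<bullet> m) *\<^sub>R D = (cross3 D v \<bullet> m) *\<^sub>R u + (cross3 u D \<bullet> m) *\<^sub>R v + (D \<bullet> m) *\<^sub>R m"
      unfolding m_def vec_eq_iff forall_3 by (simp add: cross_components inner_vec_def sum_3 algebra_simps)
    also have "\<dots> = (m \<bullet> m) *\<^sub>R (a *\<^sub>R u + b *\<^sub>R v)"
      using m det by (simp add: a_def b_def m_def D_def scaleR_right_distrib)
    finally have "D = a *\<^sub>R u + b *\<^sub>R v" using m by simp
    then have "A + a *\<^sub>R u = B + (- b) *\<^sub>R v" by (simp add: D_def algebra_simps)
    then have "A + a *\<^sub>R u \<in> line_through A u \<inter> line_through B v"
      unfolding line_through_def by blast
    then show False using skew by (auto simp: skew_def)
  qed
qed

lemma orbit_dense_space: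
  assumes u: "norm u = 1" and v: "norm v = 1"
    and skew: "skew (line_through A u) (line_through B v)"
    and inf: "infinite_order (rotation3 A u s)" "infinite_order (rotation3 B v t)"
  shows "closure (orbit_of V (stationary_group {rotation3 A u s, rotation3 B v t})) = UNIV"
proof (rule full_axes_imp_UNIV)
  let ?C = "closure (orbit_of V (stationary_group {rotation3 A u s, rotation3 B v t}))"
  show "full_axis ?C A u" "full_axis ?C B v"
    using u v inf by (auto intro: full_axis_closure_orbit[where t = s] full_axis_closure_orbit[where t = t]
        simp: rotation3_isometry)
  show "(B - A) \<bullet> cross3 u v \<noteq> 0" by (rule skew_imp_determinant_nonzero[OF u v skew])
qed (simp add: orbit_of_nonempty)

theorem theorem4p1:
  shows "(\<forall>(U1::real^2) (U2::real^2) (t1::real) (t2::real) r1 r2.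
            U1 \<noteq> U2 \<and> r1 = rotation2 U1 t1 \<and> r2 = rotation2 U2 t2 \<and>
            infinite_order r1 \<and> infinite_order r2 \<longrightarrow>
            (\<forall>V::real^2. closure (orbit_of V (stationary_group {r1, r2})) = UNIV))
       \<and> (\<forall>(A1::real^3) (u1::real^3) (A2::real^3) (u2::real^3) (t1::real) (t2::real) r1 r2.
            norm u1 = 1 \<and> norm u2 = 1 \<and> skew (line_through A1 u1) (line_through A2 u2) \<and>
            r1 = rotation3 A1 u1 t1 \<and> r2 = rotation3 A2 u2 t2 \<and>
            infinite_order r1 \<and> infinite_order r2 \<longrightarrow>
            (\<forall>V::real^3. closure (orbit_of V (stationary_group {r1, r2})) = UNIV))"
  using orbit_dense_plane orbit_dense_space by blast

end
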